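(* Assume that the $\xi_n$ are i.i.d. Let $$\bar\mu'=\mathbb{E}\left(\frac1{m_0}\sum_{i=1}^NL_i\right)\qquad\text{and}\qquad\bar\sigma'^2=\mathbb{E}\left(\frac1{m_0}\sum_{i=1}^N(L_i-\bar\mu')^2\right).$$ If $|\bar\mu'|<\infty$ and $\bar\sigma'^2\in(0,\infty)$, then for every $x\in\mathbb{R}$, $$\mathbb{E}\frac{Z_n(-\infty,\bar b_n'x+\bar a_n']}{\mathbb{E}_\xi Z_n(\mathbb{R})}\to\Phi(x),$$ where $\bar a_n'=n\bar\mu'$ and $\bar b_n'=\sqrt n\,\bar\sigma'$.
   Context: Branching random walk in a random environment in time. Let $\xi=(\xi_n)_{n\ge 0}$ be a stationary and ergodic sequence of random variables with values in a measurable space $\Theta$; each realization of $\xi_n$ determines a probability distribution $\eta_n=\eta(\xi_n)$ on $\mathbb{N}\times\mathbb{R}\times\mathbb{R}\times\cdots$. Given $\xi$ (quenched law $\mathbb{P}_\xi$, expectation $\mathbb{E}_\xi$), let $X(u)=(N(u),L_1(u),L_2(u),\dots)$, indexed by finite sequences $u\in\{\emptyset\}\cup\bigcup_{n\ge1}\mathbb{N}^n$, be independent random vectors, $X(u)$ having law $\eta_n$ when the length $|u|$ equals $n$ (values $L_i(u)$ with $i>N(u)$ play no role). The initial particle $\emptyset$ is at $S_\emptyset=0$; each particle $u$ of generation $n$, located at $S_u$, is replaced by $N(u)$ particles $ui$ of generation $n+1$ located at $S_{ui}=S_u+L_i(u)$, $1\le i\le N(u)$. Let $\mathbb{T}_n$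 be the set of particles of generation $n$ and $Z_n=\sum_{u\in\mathbb{T}_n}\delta_{S_u}$ their counting measure. The annealed law $\mathbb{P}$ (expectation $\mathbb{E}$) is $\mathbb{P}_\xi$ integrated against the law of $\xi$. Write $N=N(\emptyset)$, $L_i=L_i(\emptyset)$, $m_n=\mathbb{E}_\xi N(u)$ for $|u|=n$, so $\mathbb{E}_\xi Z_n(\mathbb{R})=\prod_{i=0}^{n-1}m_i$. Standing assumption: $\mathbb{E}\log m_0\in(0,\infty)$ and $\mathbb{E}\frac{N}{m_0}\log^+N<\infty$. $\Phi$ is the distribution function of the standard normal law. *)

theory Defs
  imports "HOL-Probability.Probability"
begin

text \<open>
  The label \<open>X(u) = (N(u), L_1(u), L_2(u), ...)\<close> of a vertex is a pair; the displacements and the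
  children are numbered from 0, so \<open>L_i(u)\<close> is component \<open>i - 1\<close> of the second entry,
  and the children of \<open>u\<close> are \<open>u @ [i]\<close> with \<open>i < N(u)\<close>. Vertices are finite sequences, i.e. lists.
\<close>

type_synonym label = "nat \<times> (nat \<Rightarrow> real)"
type_synonym labelling = "nat list \<Rightarrow> label"

definition label_space :: "label measure" where
  "label_space = count_space UNIV \<Otimes>\<^sub>M (\<Pi>\<^sub>M i\<in>UNIV. borel)"

definition labelling_space :: "labelling measure" where
  "labelling_space = (\<Pi>\<^sub>M u\<in>UNIV. label_space)"

definition offspring :: "labelling \<Rightarrow> nat list \<Rightarrow> nat" where
  "offspring X u = fst (X u)"

definition displacement :: "labelling \<Rightarrow> nat list \<Rightarrow> nat \<Rightarrow> real" where
  "displacement X u i = snd (X u) i"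

fun particles :: "labelling \<Rightarrow> nat \<Rightarrow> nat list set" where
  "particles X 0 = {[]}"
| "particles X (Suc n) = {u @ [i] | u i. u \<in> particles X n \<and> i < offspring X u}"

definition position :: "labelling \<Rightarrow> nat list \<Rightarrow> real" where
  "position X u = (\<Sum>k<length u. displacement X (take k u) (u ! k))"

text \<open>The counting measure \<open>Z_n\<close>, a sum of unit point masses, as a function of the set \<open>A\<close>.\<close>

definition Z :: "nat \<Rightarrow> labelling \<Rightarrow> real set \<Rightarrow> real" where
  "Z n X A = (\<Sum>u\<in>particles X n. indicator A (position X u))"

text \<open>The law \<open>P_\<xi>\<close> of the labelling for a fixed realization \<open>xs\<close> of the environment.\<close>

definition quenched :: "('e \<Rightarrow> label measure) \<Rightarrow> (nat \<Rightarrow> 'e) \<Rightarrow> labelling measure" where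
  "quenched eta xs = (\<Pi>\<^sub>M u\<in>UNIV. eta (xs (length u)))"

definition env_law :: "'w measure \<Rightarrow> 'e measure \<Rightarrow> (nat \<Rightarrow> 'w \<Rightarrow> 'e) \<Rightarrow> (nat \<Rightarrow> 'e) measure" where
  "env_law M Theta xi = distr M (\<Pi>\<^sub>M n\<in>UNIV. Theta) (\<lambda>w n. xi n w)"

text \<open>
  The annealed law is taken as the joint law of the environment and the labelling, because the
  integrands involve the random environment through quenched means.
\<close>

definition annealed ::
  "'w measure \<Rightarrow> 'e measure \<Rightarrow> (nat \<Rightarrow> 'w \<Rightarrow> 'e) \<Rightarrow> ('e \<Rightarrow> label measure)
    \<Rightarrow> ((nat \<Rightarrow> 'e) \<times> labelling) measure" where
  "annealed M Theta xi eta =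
     env_law M Theta xi \<bind>
       (\<lambda>xs. distr (quenched eta xs) ((\<Pi>\<^sub>M n\<in>UNIV. Theta) \<Otimes>\<^sub>M labelling_space) (\<lambda>X. (xs, X)))"

text \<open>
  \<open>m_n = E_\<xi> N(u)\<close> does not depend on the choice of \<open>u\<close> of length \<open>n\<close>; we take \<open>u = (0, ..., 0)\<close>.
  The Bochner integral is 0 when \<open>N(u)\<close> is not integrable, so the standing assumption below
  requires integrability explicitly.
\<close>

definition mean_offspring :: "('e \<Rightarrow> label measure) \<Rightarrow> (nat \<Rightarrow> 'e) \<Rightarrow> nat \<Rightarrow> real" where
  "mean_offspring eta xs n = (\<integral>X. real (offspring X (replicate n 0)) \<partial>quenched eta xs)"

text \<open>
  \<open>E log m_0 \<in> (0, \<infinity>)\<close> and \<open>E (N / m_0) log\<^sup>+ N < \<infinity>\<close>. With \<open>log 0 = -\<infinity>\<close> and \<open>log \<infinity> = \<infinity>\<close>,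
  finiteness of \<open>E log m_0\<close> includes \<open>0 < m_0 < \<infinity>\<close> almost surely; since \<open>ln 0 = 0\<close> here,
  this has to be stated separately.
\<close>

definition standing_assumption ::
  "'w measure \<Rightarrow> 'e measure \<Rightarrow> (nat \<Rightarrow> 'w \<Rightarrow> 'e) \<Rightarrow> ('e \<Rightarrow> label measure) \<Rightarrow> bool" where
  "standing_assumption M Theta xi eta \<longleftrightarrow>
     (AE xs in env_law M Theta xi.
        integrable (quenched eta xs) (\<lambda>X. real (offspring X [])) \<and> 0 < mean_offspring eta xs 0) \<and>
     integrable (annealed M Theta xi eta) (\<lambda>(xs, X). ln (mean_offspring eta xs 0)) \<and>
     0 < (\<integral>(xs, X). ln (mean_offspring eta xs 0) \<partial>annealed M Theta xi eta) \<and>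
     (\<integral>\<^sup>+(xs, X). ennreal (real (offspring X []) / mean_offspring eta xs 0
        * max 0 (ln (real (offspring X [])))) \<partial>annealed M Theta xi eta) < \<infinity>"

end

theory Submission
  imports Defs
begin

text \<open>
  Dividing the quenched mean of the children of one particle by its total mass \<open>m_n\<close> gives a random
  step law on the line. Conditioning on the first \<open>n\<close> generations (each label is independent of the
  ancestry of its vertex) shows that \<open>E_\<xi> Z_n / E_\<xi> Z_n(R)\<close> is the convolution of these
  step laws over the first \<open>n\<close> environments. As the environments are i.i.d., averaging turns it into
  the \<open>n\<close>-fold convolution of one fixed probability law, the averaged step law, whose mean
  and variance are \<open>mu\<close> and \<open>sigma2\<close>; the classical central limit theorem applies.
\<close>

section \<open>Product measures and normalized sums\<close>

text \<open>The quenched total is the product of the \<open>m_i\<close>, so each factor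
  \<open>1 / m_i\<close> can be charged to its own generation. The environment of a generation then
  enters one step law only, and the whole expression is linear in each step law; this is why
  independence replaces every random step law by its average. The obstacles are measurability in the
  environment and the exceptional environments whose mean is 0 or infinite. Both are met by
  representing a step law by its action on nonnegative functions with values in
  \<open>ennreal\<close>: convolution becomes composition of operators, every exchange of sum and
  integral is Tonelli, and real integrals return only once the means are known to be positive and
  finite. The averaged law has variance \<open>sigma2\<close> because the squares are centred at the
  deterministic \<open>mu\<close>: the fluctuation of the quenched means is part of it.\<close>

lemma measurable_sum_upto_random:
  fixes f :: "nat \<Rightarrow> 'a \<Rightarrow> 'b::{second_countable_topology, topological_comm_monoid_add}"
  assumes [measurable]: "N \<in> M \<rightarrow>\<^sub>M count_space UNIV" "\<And>i. f i \<in> borel_measurable M"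
  shows "(\<lambda>x. \<Sum>i<N x. f i x) \<in> borel_measurable M"
  by (rule measurable_compose_countable[where f = "\<lambda>k x. \<Sum>i<k. f i x"]) measurable

text \<open>The image of \<open>M k\<close> times the product law under \<open>X(k := l)\<close> is
  again the product law, as the overwritten coordinate is discarded. This serves as conditioning on
  all labels but one without splitting the index set.\<close>

lemma nn_integral_PiM_resample:
  assumes M: "\<And>i. prob_space (M i)"
    and f [measurable]: "f \<in> borel_measurable (PiM UNIV M)"
  shows "(\<integral>\<^sup>+X. f X \<partial>PiM UNIV M) = (\<integral>\<^sup>+X. (\<integral>\<^sup>+l. f (X(k := l)) \<partial>M k) \<partial>PiM UNIV M)"
proof -
  interpret Mk: prob_space "M k" by (rule M)
  interpret P: prob_space "PiM UNIV M" by (intro prob_space_PiM M)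
  interpret pair_sigma_finite "M k" "PiM UNIV M" ..
  have *: "(\<lambda>(l, X). X(k := l)) \<in> M k \<Otimes>\<^sub>M PiM UNIV M \<rightarrow>\<^sub>M PiM UNIV M"
    using measurable_fun_upd[of UNIV UNIV k snd "M k \<Otimes>\<^sub>M PiM UNIV M" M fst]
    by (simp add: case_prod_beta')
  note [measurable] = *[unfolded case_prod_beta']
  have "(\<integral>\<^sup>+X. f X \<partial>PiM UNIV M)
      = (\<integral>\<^sup>+X. f X \<partial>distr (M k \<Otimes>\<^sub>M PiM UNIV M) (PiM UNIV M) (\<lambda>(l, X). X(k := l)))"
    using distr_pair_PiM_eq_PiM[of UNIV M k] M by simp
  also have "\<dots> = (\<integral>\<^sup>+p. f ((snd p)(k := fst p)) \<partial>(M k \<Otimes>\<^sub>M PiM UNIV M))"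
    by (subst nn_integral_distr) (use * in \<open>auto simp: case_prod_beta'\<close>)
  also have "\<dots> = (\<integral>\<^sup>+X. (\<integral>\<^sup>+l. f (X(k := l)) \<partial>M k) \<partial>PiM UNIV M)"
    by (subst nn_integral_snd[symmetric]) (auto simp: case_prod_beta')
  finally show ?thesis .
qed

text \<open>An i.i.d. sequence is a first coordinate followed by an independent copy of the whole
  sequence. This is applied both to the environments and to the steps of the averaged walk.\<close>

lemma nn_integral_PiM_case_nat:
  assumes M: "prob_space M" and [measurable]: "f \<in> borel_measurable (PiM UNIV (\<lambda>_::nat. M))"
  shows "(\<integral>\<^sup>+x. f x \<partial>PiM UNIV (\<lambda>_. M))
    = (\<integral>\<^sup>+e. (\<integral>\<^sup>+x. f (case_nat e x) \<partial>PiM UNIV (\<lambda>_. M)) \<partial>M)"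
proof -
  interpret M: prob_space M by (rule M)
  interpret S: sequence_space M ..
  interpret pair_sigma_finite M "PiM UNIV (\<lambda>_::nat. M)" ..
  have "(\<integral>\<^sup>+x. f x \<partial>PiM UNIV (\<lambda>_. M))
    = (\<integral>\<^sup>+x. f x \<partial>distr (M \<Otimes>\<^sub>M PiM UNIV (\<lambda>_. M)) (PiM UNIV (\<lambda>_. M)) (\<lambda>(e, x). case_nat e x))"
    by (simp add: S.PiM_iter)
  also have "\<dots> = (\<integral>\<^sup>+p. f (case_nat (fst p) (snd p)) \<partial>(M \<Otimes>\<^sub>M PiM UNIV (\<lambda>_. M)))"
    by (subst nn_integral_distr) (auto simp: case_prod_beta')
  also have "\<dots> = (\<integral>\<^sup>+e. (\<integral>\<^sup>+x. f (case_nat e x) \<partial>PiM UNIV (\<lambda>_. M)) \<partial>M)"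
    by (subst S.nn_integral_fst[symmetric]) auto
  finally show ?thesis .
qed

lemma nn_integral_count_space_lessThan:
  "(\<integral>\<^sup>+i. indicator {..<n} i * f i \<partial>count_space UNIV) = (\<Sum>i<n. f i)" for n :: nat
proof -
  have "(\<Sum>i<n. f i) = (\<integral>\<^sup>+i. f i \<partial>count_space {..<n})"
    by (simp add: nn_integral_count_space_finite)
  also have "\<dots> = (\<integral>\<^sup>+i. f i * indicator {..<n} i \<partial>count_space UNIV)"
    by (simp add: nn_integral_count_space_indicator)
  finally show ?thesis by (simp add: mult.commute)
qed

section \<open>The central limit theorem for i.i.d. steps, as convergence of distribution
  functions\<close>

lemma emeasure_std_normal_singleton: "emeasure std_normal_distribution {x} = 0"
proof -
  have "AE y in lborel. std_normal_density y * indicator {x} y = 0"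
    using AE_lborel_singleton[of x] by eventually_elim auto
  then show ?thesis
    by (subst emeasure_density) (auto simp: nn_integral_0_iff_AE indicator_def)
qed

text \<open>Weak convergence gives convergence of distribution functions only at continuity points;
  the normal law has no atoms, so every \<open>x\<close> is one.\<close>

lemma isCont_cdf_std_normal: "isCont (cdf std_normal_distribution) x"
  using finite_borel_measure.isCont_cdf[of std_normal_distribution x] real_dist_normal_dist
    emeasure_std_normal_singleton[of x]
  by (simp add: measure_def real_distribution.finite_borel_measure_M)

lemma indep_vars_PiM_coordinates:
  assumes "prob_space R"
  shows "prob_space.indep_vars (PiM UNIV (\<lambda>_::nat. R)) (\<lambda>_. R) (\<lambda>i y. y i) UNIV"
proof -
  interpret prob_space "PiM UNIV (\<lambda>_::nat. R)" by (intro prob_space_PiM assms)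
  have "distr (PiM UNIV (\<lambda>_. R)) R (\<lambda>y. y i) = R" for i :: nat
    using assms by (intro distr_PiM_component) auto
  then show ?thesis
    by (subst indep_vars_iff_distr_eq_PiM) (simp_all add: distr_id2 restrict_def[abs_def])
qed

text \<open>The variables are the coordinates of a product space, the form in which the averaged
  walk arises. They are centred in \<open>?X\<close>, and the centring is undone when the event is
  rewritten.\<close>

lemma iid_central_limit:
  assumes R: "prob_space R" and sets_R [measurable_cong]: "sets R = sets borel"
    and sq: "integrable R (\<lambda>y. (y - mu)\<^sup>2)" and mean: "(\<integral>y. y \<partial>R) = mu"
    and var: "(\<integral>y. (y - mu)\<^sup>2 \<partial>R) = s\<^sup>2" and s: "0 < s"
  shows "(\<lambda>n. measure (PiM UNIV (\<lambda>_::nat. R))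
      {y \<in> space (PiM UNIV (\<lambda>_. R)). (\<Sum>i<n. y i) \<le> sqrt (real n) * s * x + real n * mu})
    \<longlonglongrightarrow> cdf std_normal_distribution x"
proof -
  interpret R: prob_space R by (rule R)
  interpret P: prob_space "PiM UNIV (\<lambda>_::nat. R)" by (intro prob_space_PiM R)
  let ?P = "PiM UNIV (\<lambda>_::nat. R)" and ?X = "\<lambda>i y. y i - mu"
  have comp: "distr ?P R (\<lambda>y. y n) = R" for n
    using R by (intro distr_PiM_component) auto
  have int: "integrable R (\<lambda>y. y)"
  proof -
    have "integrable R (\<lambda>y. y - mu)"
      by (rule R.square_integrable_imp_integrable[OF _ sq]) simp
    then have "integrable R (\<lambda>y. (y - mu) + mu)" by (intro Bochner_Integration.integrable_add) auto
    then show ?thesis by simp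
  qed
  have E0: "P.expectation (?X n) = 0" for n
  proof -
    have "P.expectation (?X n) = (\<integral>y. y - mu \<partial>distr ?P R (\<lambda>y. y n))"
      by (rule integral_distr[symmetric]) simp_all
    also have "\<dots> = 0"
      unfolding comp using int mean by (simp add: R.prob_space)
    finally show ?thesis .
  qed
  have "weak_conv_m (\<lambda>n. distr ?P borel (\<lambda>y. (\<Sum>i<n. ?X i y) / sqrt (real n * s\<^sup>2)))
    std_normal_distribution"
  proof (rule P.central_limit_theorem_zero_mean[where \<mu> = "distr R borel (\<lambda>y. y - mu)"])
    have "P.indep_vars (\<lambda>_. borel) (\<lambda>i. (\<lambda>z. z - mu) \<circ> (\<lambda>y. y i)) UNIV"
      by (rule P.indep_vars_compose[OF indep_vars_PiM_coordinates[OF R]]) simp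
    then show "P.indep_vars (\<lambda>_. borel) ?X UNIV" by (simp add: comp_def)
    show "P.expectation (?X n) = 0" for n by (rule E0)
    show "integrable ?P (\<lambda>y. (?X n y)\<^sup>2)" for n
    proof -
      have "integrable (distr ?P R (\<lambda>y. y n)) (\<lambda>y. (y - mu)\<^sup>2)" unfolding comp by (rule sq)
      then show ?thesis by (rule integrable_distr[rotated]) simp
    qed
    show "P.variance (?X n) = s\<^sup>2" for n
    proof -
      have "P.variance (?X n) = (\<integral>y. (y n - mu)\<^sup>2 \<partial>?P)" unfolding E0 by simp
      also have "\<dots> = (\<integral>y. (y - mu)\<^sup>2 \<partial>distr ?P R (\<lambda>y. y n))"
        by (rule integral_distr[symmetric]) simp_all
      finally show ?thesis unfolding comp var .
    qed
    show "distr ?P borel (?X n) = distr R borel (\<lambda>y. y - mu)" for n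
    proof -
      have "distr R borel (\<lambda>y. y - mu) = distr (distr ?P R (\<lambda>y. y n)) borel (\<lambda>y. y - mu)"
        by (simp only: comp)
      also have "\<dots> = distr ?P borel ((\<lambda>y. y - mu) \<circ> (\<lambda>y. y n))"
        by (rule distr_distr) simp_all
      finally show ?thesis by (simp add: comp_def)
    qed
  qed (rule s)
  then have lim: "(\<lambda>n. cdf (distr ?P borel (\<lambda>y. (\<Sum>i<n. ?X i y) / sqrt (real n * s\<^sup>2))) x)
      \<longlonglongrightarrow> cdf std_normal_distribution x"
    using isCont_cdf_std_normal by (simp add: weak_conv_m_def weak_conv_def)
  \<comment> \<open>For \<open>n = 0\<close> the quotient is 0 by convention and is compared with
    \<open>x\<close>, whereas the event on the right is the whole space; hence
    \<open>0 < n\<close>.\<close>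
  have eq: "cdf (distr ?P borel (\<lambda>y. (\<Sum>i<n. ?X i y) / sqrt (real n * s\<^sup>2))) x
    = measure ?P {y \<in> space ?P. (\<Sum>i<n. y i) \<le> sqrt (real n) * s * x + real n * mu}"
    if "0 < n" for n
  proof -
    have "cdf (distr ?P borel (\<lambda>y. (\<Sum>i<n. ?X i y) / sqrt (real n * s\<^sup>2))) x
      = measure ?P ((\<lambda>y. (\<Sum>i<n. ?X i y) / sqrt (real n * s\<^sup>2)) -` {..x} \<inter> space ?P)"
      unfolding cdf_def by (rule measure_distr) simp_all
    also have "(\<lambda>y. (\<Sum>i<n. ?X i y) / sqrt (real n * s\<^sup>2)) -` {..x} \<inter> space ?P
      = {y \<in> space ?P. (\<Sum>i<n. y i) \<le> sqrt (real n) * s * x + real n * mu}"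
      using that s by (auto simp: real_sqrt_mult sum_subtractf pos_divide_le_eq algebra_simps)
    finally show ?thesis .
  qed
  show ?thesis
    by (rule Lim_transform_eventually[OF lim])
      (use eq in \<open>auto simp: eventually_sequentially intro!: exI[of _ 1]\<close>)
qed

section \<open>Particles and their labels\<close>

lemma space_label_space [simp]: "space label_space = UNIV"
  by (simp add: label_space_def space_pair_measure space_PiM)

lemma space_labelling_space [simp]: "space labelling_space = UNIV"
  by (simp add: labelling_space_def space_PiM)

lemma measurable_fst_label [measurable]: "fst \<in> label_space \<rightarrow>\<^sub>M count_space UNIV"
  by (simp add: label_space_def)

lemma measurable_snd_label [measurable]: "(\<lambda>l. snd l i) \<in> borel_measurable label_space"
  unfolding label_space_def by measurable

lemma measurable_label [measurable]: "(\<lambda>X. X u) \<in> labelling_space \<rightarrow>\<^sub>M label_space"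
  unfolding labelling_space_def by measurable

lemma measurable_offspring [measurable]:
  "(\<lambda>X. offspring X u) \<in> labelling_space \<rightarrow>\<^sub>M count_space UNIV"
  unfolding offspring_def by measurable

lemma measurable_displacement [measurable]:
  "(\<lambda>X. displacement X u i) \<in> borel_measurable labelling_space"
  unfolding displacement_def by measurable

lemma measurable_position [measurable]:
  "(\<lambda>X. position X u) \<in> borel_measurable labelling_space"
  unfolding position_def by measurable

text \<open>The recursion is unfolded into a condition on the labels of the proper prefixes of
  \<open>u\<close>. This form makes the birth of \<open>u\<close> a measurable event and shows that
  the label of \<open>u\<close> itself does not enter it.\<close>

lemma particles_eq:
  "particles X n = {u. length u = n \<and> (\<forall>k<n. u ! k < offspring X (take k u))}"
proof (induction n)
  case (Suc n)
  have "u \<in> particles X (Suc n) \<longleftrightarrow>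
    length u = Suc n \<and> (\<forall>k<Suc n. u ! k < offspring X (take k u))" for u
  proof (cases u rule: rev_cases)
    case (snoc v i)
    then show ?thesis
      using Suc by (auto simp: nth_append less_Suc_eq)
  qed (use Suc in auto)
  then show ?case by blast
qed auto

lemma finite_particles: "finite (particles X n)"
proof (induction n)
  case (Suc n)
  have "particles X (Suc n) = (\<Union>u\<in>particles X n. (\<lambda>i. u @ [i]) ` {..<offspring X u})"
    by auto
  then show ?case using Suc by simp
qed simp

lemma length_particles: "u \<in> particles X n \<Longrightarrow> length u = n"
  by (simp add: particles_eq)

lemma sum_particles_Suc:
  fixes f :: "nat list \<Rightarrow> 'a::comm_monoid_add"
  shows "(\<Sum>u\<in>particles X (Suc n). f u) = (\<Sum>u\<in>particles X n. \<Sum>i<offspring X u. f (u @ [i]))"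
proof -
  have "(\<Sum>u\<in>particles X n. \<Sum>i<offspring X u. f (u @ [i]))
      = (\<Sum>(u, i)\<in>(SIGMA u:particles X n. {..<offspring X u}). f (u @ [i]))"
    by (rule sum.Sigma) (auto simp: finite_particles)
  also have "\<dots> = (\<Sum>u\<in>particles X (Suc n). f u)"
    by (rule sum.reindex_bij_witness[of _ "\<lambda>v. (butlast v, last v)" "\<lambda>(u, i). u @ [i]"]) auto
  finally show ?thesis ..
qed

lemma position_snoc: "position X (u @ [i]) = position X u + displacement X u i"
  by (simp add: position_def nth_append)

lemma pred_particles [measurable]: "Measurable.pred labelling_space (\<lambda>X. u \<in> particles X n)"
  unfolding particles_eq by simp

text \<open>Ancestry reads only the labels at \<open>take k u\<close> with
  \<open>k < length u\<close>, and these vertices are shorter than \<open>u\<close>. With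
  \<open>position_upd\<close> this is the independence exploited when the label of \<open>u\<close>
  is resampled.\<close>

lemma particles_upd: "length u = n \<Longrightarrow> u \<in> particles (X(u := l)) n \<longleftrightarrow> u \<in> particles X n"
  by (auto simp: particles_eq offspring_def)

lemma position_upd: "position (X(u := l)) u = position X u"
  unfolding position_def displacement_def
  by (rule sum.cong) (auto dest: arg_cong[of _ _ length])

text \<open>The random index set moves into the integrand, so that exchanging the sum over particles
  with an expectation becomes Tonelli over the countable type of vertices.\<close>

lemma sum_particles_eq_nn_integral:
  fixes f :: "nat list \<Rightarrow> ennreal"
  shows "(\<Sum>u\<in>particles X n. f u) = (\<integral>\<^sup>+u. indicator (particles X n) u * f u \<partial>count_space UNIV)"
proof -
  have "(\<Sum>u\<in>particles X n. f u) = (\<integral>\<^sup>+u. f u \<partial>count_space (particles X n))"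
    by (simp add: nn_integral_count_space_finite finite_particles)
  also have "\<dots> = (\<integral>\<^sup>+u. f u * indicator (particles X n) u \<partial>count_space UNIV)"
    by (simp add: nn_integral_count_space_indicator)
  finally show ?thesis by (simp add: mult.commute)
qed

text \<open>The range of summation is random. \<open>sum_particles_Suc\<close> reduces it to the
  previous generation, at the price of a summand that has a random number of terms; hence
  \<open>f\<close> depends on the labelling and is generalized.\<close>

lemma measurable_sum_particles [measurable]:
  fixes f :: "nat list \<Rightarrow> labelling \<Rightarrow> 'a::{second_countable_topology, topological_comm_monoid_add}"
  assumes "\<And>u. f u \<in> borel_measurable labelling_space"
  shows "(\<lambda>X. \<Sum>u\<in>particles X n. f u X) \<in> borel_measurable labelling_space"
  using assms
proof (induction n arbitrary: f)
  case (Suc n)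
  note [measurable] = Suc.prems
  have "(\<lambda>X. \<Sum>i<offspring X u. f (u @ [i]) X) \<in> borel_measurable labelling_space" for u
    by (rule measurable_sum_upto_random) measurable
  then show ?case
    unfolding sum_particles_Suc by (rule Suc.IH)
qed simp

lemma Z_nonneg: "0 \<le> Z n X A"
  by (simp add: Z_def sum_nonneg)

lemma measurable_Z [measurable]:
  assumes [measurable]: "A \<in> sets borel"
  shows "(\<lambda>X. Z n X A) \<in> borel_measurable labelling_space"
  unfolding Z_def by (rule measurable_sum_particles) measurable

lemma ennreal_Z: "ennreal (Z n X A) = (\<Sum>u\<in>particles X n. indicator A (position X u))"
  by (simp add: Z_def sum_ennreal[symmetric] ennreal_indicator)

section \<open>Quenched and annealed step operators\<close>

text \<open>The i.i.d. assumption is built in through the product \<open>env\<close>; the variables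
  \<open>xi\<close> enter only through \<open>nu\<close>, to be taken as the law of
  \<open>xi 0\<close>.\<close>

locale random_environment =
  fixes Theta :: "'e measure" and eta :: "'e \<Rightarrow> label measure" and nu :: "'e measure"
  assumes kernel [measurable]: "eta \<in> Theta \<rightarrow>\<^sub>M prob_algebra label_space"
    and prob_nu: "prob_space nu"
    and sets_nu [measurable_cong]: "sets nu = sets Theta"
begin

abbreviation env :: "(nat \<Rightarrow> 'e) measure" where
  "env \<equiv> PiM UNIV (\<lambda>_. nu)"

abbreviation envs :: "(nat \<Rightarrow> 'e) measure" where
  "envs \<equiv> PiM UNIV (\<lambda>_. Theta)"

lemma space_nu: "space nu = space Theta"
  by (rule sets_eq_imp_space_eq) (rule sets_nu)

lemma sets_env [measurable_cong]: "sets env = sets envs"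
  by (intro sets_PiM_cong) (auto simp: sets_nu)

lemma space_env: "space env = space envs"
  by (rule sets_eq_imp_space_eq) (rule sets_env)

lemma prob_env: "prob_space env"
  by (intro prob_space_PiM prob_nu)

lemma space_envsD: "xs \<in> space envs \<Longrightarrow> xs n \<in> space Theta"
  by (auto simp: space_PiM)

lemma
  assumes "e \<in> space Theta"
  shows prob_eta: "prob_space (eta e)" and sets_eta: "sets (eta e) = sets label_space"
  using measurable_space[OF kernel assms] by (auto simp: space_prob_algebra)

lemma sets_quenched: "xs \<in> space envs \<Longrightarrow> sets (quenched eta xs) = sets labelling_space"
  unfolding quenched_def labelling_space_def
  by (intro sets_PiM_cong) (auto simp: sets_eta space_envsD)

lemma prob_quenched: "xs \<in> space envs \<Longrightarrow> prob_space (quenched eta xs)"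
  unfolding quenched_def by (intro prob_space_PiM prob_eta space_envsD)

text \<open>On a finite cylinder the quenched probability is a finite product of kernel values, each
  measurable in the environment. Cylinders are stable under intersection and generate, which
  suffices for probability kernels.\<close>

lemma measurable_quenched [measurable]:
  "quenched eta \<in> envs \<rightarrow>\<^sub>M prob_algebra labelling_space"
proof (rule measurable_prob_algebra_generated[where \<Omega> = "\<Pi>\<^sub>E u\<in>UNIV. space label_space"
      and G = "prod_algebra UNIV (\<lambda>_. label_space)"])
  show "sets labelling_space = sigma_sets (\<Pi>\<^sub>E u\<in>UNIV. space label_space) (prod_algebra UNIV (\<lambda>_. label_space))"
    unfolding labelling_space_def by (rule sets_PiM)
  show "Int_stable (prod_algebra UNIV (\<lambda>_::nat list. label_space))"
    by (rule Int_stable_prod_algebra)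
  show "prod_algebra UNIV (\<lambda>_. label_space) \<subseteq> Pow (\<Pi>\<^sub>E u\<in>UNIV. space label_space)"
    using prod_algebra_sets_into_space[of UNIV "\<lambda>_. label_space"] .
  fix A :: "labelling set" assume "A \<in> prod_algebra UNIV (\<lambda>_. label_space)"
  then obtain J E where A: "A = prod_emb UNIV (\<lambda>_. label_space) J (Pi\<^sub>E J E)"
    and J: "finite J" and E [measurable]: "\<And>j. j \<in> J \<Longrightarrow> E j \<in> sets label_space"
    by (auto elim!: prod_algebraE)
  have "emeasure (quenched eta xs) A = (\<Prod>u\<in>J. emeasure (eta (xs (length u))) (E u))"
    if xs: "xs \<in> space envs" for xs
  proof -
    \<comment> \<open>A cylinder depends only on the underlying spaces, which the laws
      \<open>eta e\<close> share with \<open>label_space\<close>.\<close>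
    have "A = prod_emb UNIV (\<lambda>u. eta (xs (length u))) J (Pi\<^sub>E J E)"
      unfolding A prod_emb_def using sets_eq_imp_space_eq[OF sets_eta[OF space_envsD[OF xs]]] by simp
    then show ?thesis unfolding quenched_def
      using J E xs by (simp add: emeasure_PiM_emb prob_eta space_envsD sets_eta)
  qed
  moreover have "(\<lambda>xs. \<Prod>u\<in>J. emeasure (eta (xs (length u))) (E u)) \<in> borel_measurable envs"
    by (intro borel_measurable_prod_ennreal measurable_emeasure_kernel[where N = label_space]
      measurable_prob_algebraD[OF measurable_compose[OF _ kernel]] E) auto
  ultimately show "(\<lambda>xs. emeasure (quenched eta xs) A) \<in> borel_measurable envs"
    by (simp cong: measurable_cong)
qed (simp_all add: prob_quenched sets_quenched)

section \<open>Step operators on nonnegative functions and the many-to-one formula\<close>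

definition mean_children :: "'e \<Rightarrow> ennreal" where
  "mean_children e = (\<integral>\<^sup>+l. of_nat (fst l) \<partial>eta e)"

definition child_sum :: "'e \<Rightarrow> (real \<Rightarrow> ennreal) \<Rightarrow> real \<Rightarrow> ennreal" where
  "child_sum e g s = (\<integral>\<^sup>+l. (\<Sum>i<fst l. g (s + snd l i)) \<partial>eta e)"

text \<open>This is the integral of \<open>g (s + y)\<close> against the step law of environment
  \<open>e\<close>. Values in \<open>ennreal\<close> keep it defined when the mean is 0 or
  infinite.\<close>

definition step :: "'e \<Rightarrow> (real \<Rightarrow> ennreal) \<Rightarrow> real \<Rightarrow> ennreal" where
  "step e g s = inverse (mean_children e) * child_sum e g s"

fun steps :: "(nat \<Rightarrow> 'e) \<Rightarrow> nat \<Rightarrow> (real \<Rightarrow> ennreal) \<Rightarrow> real \<Rightarrow> ennreal" where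
  "steps xs 0 g = g"
| "steps xs (Suc n) g = step (xs 0) (steps (\<lambda>i. xs (Suc i)) n g)"

text \<open>Two recursions are needed: the branching process grows at its last generation, while
  averaging over an i.i.d. sequence splits off its first environment.\<close>

lemma steps_Suc_last: "steps xs (Suc n) g = steps xs n (step (xs n) g)"
proof (induction n arbitrary: xs)
  case (Suc n)
  show ?case using Suc[of "\<lambda>i. xs (Suc i)"] by simp
qed simp

lemma measurable_mean_children [measurable]: "mean_children \<in> borel_measurable Theta"
  unfolding mean_children_def
  by (rule nn_integral_measurable_subprob_algebra2[where N = label_space])
    (auto intro!: measurable_prob_algebraD)

text \<open>Environment, test function and starting point may all depend on \<open>w\<close>,
  because in \<open>steps\<close> the function handed to the first operator depends on the later
  environments.\<close>

lemma measurable_child_sum: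
  assumes [measurable]: "F \<in> N \<rightarrow>\<^sub>M Theta" "(\<lambda>(w, s). g w s) \<in> borel_measurable (N \<Otimes>\<^sub>M borel)"
    "h \<in> borel_measurable N"
  shows "(\<lambda>w. child_sum (F w) (g w) (h w)) \<in> borel_measurable N"
  unfolding child_sum_def
proof (rule nn_integral_measurable_subprob_algebra2[where N = label_space])
  show "(\<lambda>w. eta (F w)) \<in> N \<rightarrow>\<^sub>M subprob_algebra label_space"
    by (intro measurable_prob_algebraD) measurable
  show "(\<lambda>(w, l). \<Sum>i<fst l. g w (h w + snd l i)) \<in> borel_measurable (N \<Otimes>\<^sub>M label_space)"
    unfolding case_prod_beta by (rule measurable_sum_upto_random) measurable
qed

lemma measurable_step:
  assumes [measurable]: "F \<in> N \<rightarrow>\<^sub>M Theta" "(\<lambda>(w, s). g w s) \<in> borel_measurable (N \<Otimes>\<^sub>M borel)"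
    "h \<in> borel_measurable N"
  shows "(\<lambda>w. step (F w) (g w) (h w)) \<in> borel_measurable N"
  unfolding step_def
  by (intro borel_measurable_times_ennreal measurable_child_sum assms) measurable

lemma measurable_step1:
  assumes "e \<in> space Theta" and [measurable]: "g \<in> borel_measurable borel"
  shows "step e g \<in> borel_measurable borel" "child_sum e g \<in> borel_measurable borel"
proof -
  have *: "(\<lambda>(w, s). g s) \<in> borel_measurable ((borel :: real measure) \<Otimes>\<^sub>M borel)"
    unfolding case_prod_beta' by measurable
  show "step e g \<in> borel_measurable borel"
    by (rule measurable_step[where F = "\<lambda>_. e" and g = "\<lambda>_. g" and h = "\<lambda>s. s"]) (use assms * in auto)
  show "child_sum e g \<in> borel_measurable borel"
    by (rule measurable_child_sum[where F = "\<lambda>_. e" and g = "\<lambda>_. g" and h = "\<lambda>s. s"]) (use assms * in auto)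
qed

lemma measurable_steps [measurable]:
  assumes [measurable]: "g \<in> borel_measurable borel"
  shows "(\<lambda>(xs, s). steps xs n g s) \<in> borel_measurable (envs \<Otimes>\<^sub>M borel)"
proof (induction n)
  case (Suc n)
  \<comment> \<open>The parameter carries the environments and the point at which the outer operator
    is evaluated; the inner function takes a real argument of its own.\<close>
  have "(\<lambda>w. (\<lambda>i. fst (fst w) (Suc i), snd w))
      \<in> (envs \<Otimes>\<^sub>M (borel :: real measure)) \<Otimes>\<^sub>M borel \<rightarrow>\<^sub>M envs \<Otimes>\<^sub>M borel"
    by (intro measurable_Pair measurable_PiM_single') (auto simp: space_pair_measure space_PiM)
  from measurable_compose[OF this Suc.IH]
  have "(\<lambda>(w, s). steps (\<lambda>i. fst w (Suc i)) n g s)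
      \<in> borel_measurable ((envs \<Otimes>\<^sub>M (borel :: real measure)) \<Otimes>\<^sub>M borel)"
    unfolding case_prod_beta' by simp
  then show ?case unfolding steps.simps case_prod_beta
    by (intro measurable_step) (simp_all add: case_prod_beta)
qed simp

lemma nn_integral_eta_label:
  assumes xs: "xs \<in> space envs" and [measurable]: "f \<in> borel_measurable label_space"
  shows "(\<integral>\<^sup>+X. f (X u) \<partial>quenched eta xs) = (\<integral>\<^sup>+l. f l \<partial>eta (xs (length u)))"
proof -
  have f: "f \<in> borel_measurable (eta (xs (length u)))"
    using assms by (subst measurable_cong_sets[OF sets_eta[OF space_envsD] refl])
  have "(\<integral>\<^sup>+l. f l \<partial>eta (xs (length u)))
    = (\<integral>\<^sup>+l. f l \<partial>distr (quenched eta xs) (eta (xs (length u))) (\<lambda>X. X u))"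
    unfolding quenched_def using xs
    by (subst distr_PiM_component) (auto intro: prob_eta space_envsD)
  also have "\<dots> = (\<integral>\<^sup>+X. f (X u) \<partial>quenched eta xs)"
    using f by (intro nn_integral_distr) (auto simp: quenched_def)
  finally show ?thesis ..
qed

text \<open>For a fixed vertex \<open>u\<close> of length \<open>n\<close> the label at
  \<open>u\<close> is resampled: birth and position of \<open>u\<close> do not change, and
  integrating out the fresh label produces \<open>child_sum\<close>. Summing over all vertices
  replaces conditioning on a sigma-algebra.\<close>

lemma nn_integral_particles_Suc:
  assumes xs: "xs \<in> space envs" and g [measurable]: "g \<in> borel_measurable borel"
  shows "(\<integral>\<^sup>+X. (\<Sum>u\<in>particles X (Suc n). g (position X u)) \<partial>quenched eta xs)
    = (\<integral>\<^sup>+X. (\<Sum>u\<in>particles X n. child_sum (xs n) g (position X u)) \<partial>quenched eta xs)"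
proof -
  note [measurable_cong] = sets_quenched[OF xs]
  let ?F = "\<lambda>u X. \<Sum>i<offspring X u. g (position X u + displacement X u i)"
  have meas [measurable]: "?F u \<in> borel_measurable labelling_space" for u
    by (rule measurable_sum_upto_random) measurable
  have [measurable]: "child_sum (xs n) g \<in> borel_measurable borel"
    by (rule measurable_step1) (use xs in \<open>auto intro: space_envsD\<close>)
  have *: "(\<integral>\<^sup>+X. indicator (particles X n) u * ?F u X \<partial>quenched eta xs)
    = (\<integral>\<^sup>+X. indicator (particles X n) u * child_sum (xs n) g (position X u) \<partial>quenched eta xs)" for u
  proof (cases "length u = n")
    case True
    have "(\<integral>\<^sup>+X. indicator (particles X n) u * ?F u X \<partial>quenched eta xs)
      = (\<integral>\<^sup>+X. (\<integral>\<^sup>+l. indicator (particles (X(u := l)) n) u * ?F u (X(u := l)) \<partial>eta (xs (length u)))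
          \<partial>quenched eta xs)"
      unfolding quenched_def
    proof (rule nn_integral_PiM_resample)
      show "(\<lambda>X. indicator (particles X n) u * ?F u X)
          \<in> borel_measurable (\<Pi>\<^sub>M u\<in>UNIV. eta (xs (length u)))"
        unfolding quenched_def[symmetric] by measurable
    qed (use xs in \<open>auto intro: prob_eta space_envsD\<close>)
    also have "\<dots> = (\<integral>\<^sup>+X. (\<integral>\<^sup>+l. indicator (particles X n) u *
        (\<Sum>i<fst l. g (position X u + snd l i)) \<partial>eta (xs n)) \<partial>quenched eta xs)"
      using True by (simp add: indicator_def particles_upd position_upd)
        (simp add: offspring_def displacement_def)
    also have "\<dots> = (\<integral>\<^sup>+X. indicator (particles X n) u * child_sum (xs n) g (position X u) \<partial>quenched eta xs)"
      by (auto simp: child_sum_def indicator_def intro!: nn_integral_cong)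
    finally show ?thesis .
  next
    \<comment> \<open>For another length the label has the law of another generation, but the
      indicator vanishes.\<close>
    case False
    then have "u \<notin> particles X n" for X using length_particles by blast
    then show ?thesis by simp
  qed
  have "(\<integral>\<^sup>+X. (\<Sum>u\<in>particles X n. ?F u X) \<partial>quenched eta xs)
    = (\<integral>\<^sup>+u. (\<integral>\<^sup>+X. indicator (particles X n) u * ?F u X \<partial>quenched eta xs) \<partial>count_space UNIV)"
    unfolding sum_particles_eq_nn_integral
    by (rule nn_integral_count_space_nn_integral) simp_all
  also have "\<dots> = (\<integral>\<^sup>+X. (\<integral>\<^sup>+u. indicator (particles X n) u * child_sum (xs n) g (position X u)
      \<partial>count_space UNIV) \<partial>quenched eta xs)"
    unfolding *
    by (rule nn_integral_count_space_nn_integral[symmetric]) simp_all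
  finally show ?thesis
    unfolding sum_particles_Suc position_snoc
    unfolding sum_particles_eq_nn_integral .
qed

text \<open>The normalization is a product of inverses rather than the inverse of a product, so that
  its last factor can be absorbed into \<open>step (xs n) g\<close>; therefore \<open>g\<close> is
  generalized.\<close>

lemma many_to_one:
  assumes xs: "xs \<in> space envs" and [measurable]: "g \<in> borel_measurable borel"
  shows "(\<Prod>i<n. inverse (mean_children (xs i))) *
      (\<integral>\<^sup>+X. (\<Sum>u\<in>particles X n. g (position X u)) \<partial>quenched eta xs) = steps xs n g 0"
  using assms(2)
proof (induction n arbitrary: g)
  case 0
  interpret prob_space "quenched eta xs" using xs by (rule prob_quenched)
  show ?case by (simp add: position_def emeasure_space_1)
next
  case (Suc n)
  note [measurable] = Suc.prems
  note [measurable_cong] = sets_quenched[OF xs]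
  have xsn: "xs n \<in> space Theta" using xs by (rule space_envsD)
  have [measurable]: "child_sum (xs n) g \<in> borel_measurable borel"
    by (rule measurable_step1) (use xsn in auto)
  have "(\<Prod>i<Suc n. inverse (mean_children (xs i))) *
      (\<integral>\<^sup>+X. (\<Sum>u\<in>particles X (Suc n). g (position X u)) \<partial>quenched eta xs)
    = (\<Prod>i<n. inverse (mean_children (xs i))) * (inverse (mean_children (xs n)) *
      (\<integral>\<^sup>+X. (\<Sum>u\<in>particles X n. child_sum (xs n) g (position X u)) \<partial>quenched eta xs))"
    by (simp only: nn_integral_particles_Suc[OF xs Suc.prems] prod.lessThan_Suc mult.assoc)
  also have "inverse (mean_children (xs n)) *
      (\<integral>\<^sup>+X. (\<Sum>u\<in>particles X n. child_sum (xs n) g (position X u)) \<partial>quenched eta xs)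
    = (\<integral>\<^sup>+X. (\<Sum>u\<in>particles X n. step (xs n) g (position X u)) \<partial>quenched eta xs)"
    unfolding step_def sum_distrib_left[symmetric] by (rule nn_integral_cmult[symmetric]) simp
  also have "(\<Prod>i<n. inverse (mean_children (xs i))) * \<dots> = steps xs n (step (xs n) g) 0"
    using xsn by (intro Suc.IH measurable_step1) simp_all
  finally show ?case unfolding steps_Suc_last .
qed

section \<open>The joint law of environment and labelling, and the averaged step law\<close>

definition joint_law :: "((nat \<Rightarrow> 'e) \<times> labelling) measure" where
  "joint_law = env \<bind> (\<lambda>xs. distr (quenched eta xs) (envs \<Otimes>\<^sub>M labelling_space) (\<lambda>X. (xs, X)))"

lemma measurable_joint_kernel [measurable]:
  "(\<lambda>xs. distr (quenched eta xs) (envs \<Otimes>\<^sub>M labelling_space) (\<lambda>X. (xs, X)))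
    \<in> env \<rightarrow>\<^sub>M prob_algebra (envs \<Otimes>\<^sub>M labelling_space)"
  by (rule measurable_distr_prob_space2[where M = labelling_space]) measurable

lemma env_in_prob_algebra: "env \<in> space (prob_algebra env)"
  by (simp add: space_prob_algebra prob_env)

lemma prob_joint: "prob_space joint_law"
  unfolding joint_law_def by (rule prob_space_bind'[OF env_in_prob_algebra measurable_joint_kernel])

lemma sets_joint [measurable_cong]: "sets joint_law = sets (envs \<Otimes>\<^sub>M labelling_space)"
  unfolding joint_law_def by (rule sets_bind'[OF env_in_prob_algebra measurable_joint_kernel])

lemma nn_integral_joint:
  assumes [measurable]: "f \<in> borel_measurable (envs \<Otimes>\<^sub>M labelling_space)"
  shows "(\<integral>\<^sup>+p. f p \<partial>joint_law) = (\<integral>\<^sup>+xs. (\<integral>\<^sup>+X. f (xs, X) \<partial>quenched eta xs) \<partial>env)"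
proof -
  have "(\<integral>\<^sup>+p. f p \<partial>joint_law) = (\<integral>\<^sup>+xs. (\<integral>\<^sup>+p. f p
      \<partial>distr (quenched eta xs) (envs \<Otimes>\<^sub>M labelling_space) (\<lambda>X. (xs, X))) \<partial>env)"
    unfolding joint_law_def
    by (rule nn_integral_bind[where B = "envs \<Otimes>\<^sub>M labelling_space"])
      (auto intro: measurable_prob_algebraD)
  also have "\<dots> = (\<integral>\<^sup>+xs. (\<integral>\<^sup>+X. f (xs, X) \<partial>quenched eta xs) \<partial>env)"
    by (intro nn_integral_cong nn_integral_distr)
      (auto simp: space_env measurable_cong_sets[OF sets_quenched refl])
  finally show ?thesis .
qed

lemma AE_joint_fst:
  assumes [measurable]: "Measurable.pred envs Q" and "AE xs in env. Q xs"
  shows "AE p in joint_law. Q (fst p)"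
proof -
  have "AE y in distr (quenched eta xs) (envs \<Otimes>\<^sub>M labelling_space) (\<lambda>X. (xs, X)). Q (fst y)"
    if "Q xs" "xs \<in> space env" for xs
    using that
    by (subst AE_distr_iff) (auto simp: space_env measurable_cong_sets[OF sets_quenched refl])
  then show ?thesis
    unfolding joint_law_def
    using assms(2)
    by (subst AE_bind[where B = "envs \<Otimes>\<^sub>M labelling_space"])
      (auto intro: measurable_prob_algebraD)
qed

lemma nn_integral_env_component:
  assumes [measurable]: "f \<in> borel_measurable Theta"
  shows "(\<integral>\<^sup>+xs. f (xs n) \<partial>env) = (\<integral>\<^sup>+e. f e \<partial>nu)"
proof -
  have "(\<integral>\<^sup>+e. f e \<partial>nu) = (\<integral>\<^sup>+e. f e \<partial>distr env nu (\<lambda>xs. xs n))"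
    by (subst distr_PiM_component) (auto intro: prob_nu)
  also have "\<dots> = (\<integral>\<^sup>+xs. f (xs n) \<partial>env)"
    by (rule nn_integral_distr) auto
  finally show ?thesis ..
qed

text \<open>
  The averaged step law is built by choosing the index of a child with counting measure and
  weighting by \<open>1 / m_0\<close>, so that countable additivity need not be checked by hand.
\<close>

definition child_weight :: "nat \<times> (nat \<Rightarrow> 'e) \<times> labelling \<Rightarrow> ennreal" where
  "child_weight = (\<lambda>(i, xs, X). inverse (mean_children (xs 0)) * indicator {..<offspring X []} i)"

definition child_displacement :: "nat \<times> (nat \<Rightarrow> 'e) \<times> labelling \<Rightarrow> real" where
  "child_displacement = (\<lambda>(i, xs, X). displacement X [] i)"

definition step_law :: "real measure" where
  "step_law = distr (density (count_space UNIV \<Otimes>\<^sub>M joint_law) child_weight) borel child_displacement"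

lemma sets_step_law [simp, measurable_cong]: "sets step_law = sets borel"
  by (simp add: step_law_def)

lemma measurable_child_weight [measurable]:
  "child_weight \<in> borel_measurable (count_space UNIV \<Otimes>\<^sub>M joint_law)"
  unfolding child_weight_def case_prod_beta' indicator_def by measurable

lemma measurable_child_displacement [measurable]:
  "child_displacement \<in> borel_measurable (count_space UNIV \<Otimes>\<^sub>M joint_law)"
proof (rule measurable_pair_measure_countable1)
  show "(\<lambda>p. child_displacement (i, p)) \<in> borel_measurable joint_law" for i
    by (simp add: child_displacement_def case_prod_beta')
qed simp

text \<open>Integrating the child index first, against counting measure, turns the weight into the
  finite sum over the children of the root.\<close>

lemma nn_integral_step_law_joint:
  assumes h [measurable]: "h \<in> borel_measurable borel"
  shows "(\<integral>\<^sup>+y. h y \<partial>step_law) = (\<integral>\<^sup>+(xs, X). inverse (mean_children (xs 0)) *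
      (\<Sum>i<offspring X []. h (displacement X [] i)) \<partial>joint_law)"
proof -
  interpret J: prob_space joint_law by (rule prob_joint)
  interpret C: sigma_finite_measure "count_space (UNIV :: nat set)"
    by (rule sigma_finite_measure_count_space)
  interpret pair_sigma_finite "count_space (UNIV :: nat set)" joint_law ..
  let ?H = "\<lambda>X. \<Sum>i<offspring X []. h (displacement X [] i)"
  have [measurable]: "?H \<in> borel_measurable labelling_space"
    by (rule measurable_sum_upto_random) measurable
  have "(\<integral>\<^sup>+y. h y \<partial>step_law) = (\<integral>\<^sup>+p. child_weight p * h (child_displacement p)
      \<partial>(count_space UNIV \<Otimes>\<^sub>M joint_law))"
    unfolding step_law_def
    by (subst nn_integral_distr) (simp_all add: nn_integral_density)
  also have "\<dots> = (\<integral>\<^sup>+q. (\<integral>\<^sup>+i. child_weight (i, q) * h (child_displacement (i, q))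
      \<partial>count_space UNIV) \<partial>joint_law)"
    by (rule nn_integral_snd[symmetric]) simp
  also have "\<dots> = (\<integral>\<^sup>+q. inverse (mean_children (fst q 0)) * ?H (snd q) \<partial>joint_law)"
    unfolding child_weight_def child_displacement_def case_prod_beta' fst_conv snd_conv mult.assoc
    by (subst nn_integral_cmult) (simp_all only: nn_integral_count_space_lessThan borel_measurable_count_space)
  finally show ?thesis by (simp add: case_prod_beta')
qed

text \<open>Identifies the measure with the averaged operator, the form that the recursion in
  \<open>annealed_steps\<close> meets. The root has length 0, so its label has law
  \<open>eta (xs 0)\<close> and only that environment remains.\<close>

lemma nn_integral_step_law:
  assumes h [measurable]: "h \<in> borel_measurable borel"
  shows "(\<integral>\<^sup>+y. h y \<partial>step_law) = (\<integral>\<^sup>+e. step e h 0 \<partial>nu)"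
proof -
  let ?H = "\<lambda>X. \<Sum>i<offspring X []. h (displacement X [] i)"
  have [measurable]: "?H \<in> borel_measurable labelling_space"
    by (rule measurable_sum_upto_random) measurable
  have "(\<integral>\<^sup>+y. h y \<partial>step_law)
    = (\<integral>\<^sup>+q. inverse (mean_children (fst q 0)) * ?H (snd q) \<partial>joint_law)"
    by (simp add: nn_integral_step_law_joint case_prod_beta')
  also have "\<dots> = (\<integral>\<^sup>+xs. (\<integral>\<^sup>+X. inverse (mean_children (xs 0)) * ?H X \<partial>quenched eta xs) \<partial>env)"
    by (subst nn_integral_joint) simp_all
  also have "\<dots> = (\<integral>\<^sup>+xs. step (xs 0) h 0 \<partial>env)"
  proof (rule nn_integral_cong)
    fix xs assume "xs \<in> space env"
    then have xs: "xs \<in> space envs" by (simp add: space_env)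
    have H: "?H \<in> borel_measurable (quenched eta xs)"
      by (subst measurable_cong_sets[OF sets_quenched[OF xs] refl]) simp
    have "(\<lambda>l. \<Sum>i<fst l. h (snd l i)) \<in> borel_measurable label_space"
      by (rule measurable_sum_upto_random) measurable
    from nn_integral_eta_label[OF xs this, of "[]"]
    have "(\<integral>\<^sup>+X. ?H X \<partial>quenched eta xs) = child_sum (xs 0) h 0"
      by (simp add: child_sum_def offspring_def displacement_def)
    then show "(\<integral>\<^sup>+X. inverse (mean_children (xs 0)) * ?H X \<partial>quenched eta xs) = step (xs 0) h 0"
      unfolding step_def nn_integral_cmult[OF H] by (rule arg_cong)
  qed
  also have "\<dots> = (\<integral>\<^sup>+e. step e h 0 \<partial>nu)"
  proof (rule nn_integral_env_component)
    show "(\<lambda>e. step e h 0) \<in> borel_measurable Theta"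
      by (rule measurable_step) (simp_all add: case_prod_beta')
  qed
  finally show ?thesis .
qed

text \<open>\<open>step e\<close> is a nonnegative integral operator, so Tonelli moves it past
  another integral. With \<open>N\<close> the law of the later environments, this is where their
  independence of \<open>e\<close> acts.\<close>

lemma nn_integral_step:
  assumes N: "sigma_finite_measure N" and e: "e \<in> space Theta"
    and [measurable]: "(\<lambda>(w, s). g w s) \<in> borel_measurable (N \<Otimes>\<^sub>M borel)"
  shows "(\<integral>\<^sup>+w. step e (g w) s \<partial>N) = step e (\<lambda>s. \<integral>\<^sup>+w. g w s \<partial>N) s"
proof -
  interpret N: sigma_finite_measure N by (rule N)
  interpret E: prob_space "eta e" using e by (rule prob_eta)
  interpret pair_sigma_finite N "eta e" ..
  note [measurable_cong] = sets_eta[OF e]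
  have [measurable]: "(\<lambda>p. \<Sum>i<fst (snd p). g (fst p) (s + snd (snd p) i)) \<in> borel_measurable (N \<Otimes>\<^sub>M eta e)"
    by (rule measurable_sum_upto_random) measurable
  have "(\<integral>\<^sup>+w. step e (g w) s \<partial>N)
    = inverse (mean_children e) * (\<integral>\<^sup>+w. (\<integral>\<^sup>+l. (\<Sum>i<fst l. g w (s + snd l i)) \<partial>eta e) \<partial>N)"
    unfolding step_def child_sum_def
    by (rule nn_integral_cmult) (auto intro!: E.borel_measurable_nn_integral simp: case_prod_beta')
  also have "(\<integral>\<^sup>+w. (\<integral>\<^sup>+l. (\<Sum>i<fst l. g w (s + snd l i)) \<partial>eta e) \<partial>N)
    = (\<integral>\<^sup>+l. (\<integral>\<^sup>+w. (\<Sum>i<fst l. g w (s + snd l i)) \<partial>N) \<partial>eta e)"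
    by (rule Fubini'[symmetric]) (auto simp: case_prod_beta')
  also have "\<dots> = child_sum e (\<lambda>s. \<integral>\<^sup>+w. g w s \<partial>N) s"
    unfolding child_sum_def by (intro nn_integral_cong nn_integral_sum) measurable
  finally show ?thesis by (simp add: step_def)
qed

text \<open>Both sides obey the same recursion once the first environment, respectively the first
  step, is split off. The start \<open>s\<close> is generalized because the remaining walk starts at
  \<open>s + y\<close>.\<close>

lemma annealed_steps:
  assumes rho: "prob_space step_law" and g [measurable]: "g \<in> borel_measurable borel"
  shows "(\<integral>\<^sup>+xs. steps xs n g s \<partial>env)
    = (\<integral>\<^sup>+y. g (s + (\<Sum>i<n. y i)) \<partial>PiM UNIV (\<lambda>_::nat. step_law))"
proof (induction n arbitrary: s)
  case 0
  interpret E: prob_space env by (rule prob_env)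
  interpret R: prob_space "PiM UNIV (\<lambda>_::nat. step_law)" by (intro prob_space_PiM rho)
  show ?case by (simp add: E.emeasure_space_1 R.emeasure_space_1)
next
  case (Suc n)
  interpret E: prob_space env by (rule prob_env)
  interpret R: prob_space "PiM UNIV (\<lambda>_::nat. step_law)" by (intro prob_space_PiM rho)
  define G where "G s = (\<integral>\<^sup>+xs. steps xs n g s \<partial>env)" for s
  have st [measurable]: "(\<lambda>(xs, s). steps xs k g s) \<in> borel_measurable (env \<Otimes>\<^sub>M borel)" for k
    by (subst measurable_cong_sets[OF sets_pair_measure_cong[OF sets_env refl] refl]) measurable
  have [measurable]: "G \<in> borel_measurable borel"
    unfolding G_def by measurable
  have st1: "(\<lambda>xs. steps xs k g s) \<in> borel_measurable env" for k
    using measurable_compose[OF measurable_Pair[OF measurable_ident measurable_const] st[of k], of s]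
    by simp
  have "(\<integral>\<^sup>+xs. steps xs (Suc n) g s \<partial>env)
    = (\<integral>\<^sup>+e. (\<integral>\<^sup>+xs. step e (steps xs n g) s \<partial>env) \<partial>nu)"
    using nn_integral_PiM_case_nat[OF prob_nu st1[of "Suc n"]] by simp
  also have "\<dots> = (\<integral>\<^sup>+e. step e G s \<partial>nu)"
    unfolding G_def
    by (intro nn_integral_cong nn_integral_step E.sigma_finite_measure_axioms)
      (auto simp: space_nu)
  \<comment> \<open>Translation covariance: the law of the displacements does not depend on the
    position, so the start moves into the function and the operator is evaluated at 0.\<close>
  also have "\<dots> = (\<integral>\<^sup>+e. step e (\<lambda>y. G (s + y)) 0 \<partial>nu)"
    by (simp add: step_def child_sum_def)
  also have "\<dots> = (\<integral>\<^sup>+y. G (s + y) \<partial>step_law)"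
    by (rule nn_integral_step_law[symmetric]) measurable
  also have "\<dots> = (\<integral>\<^sup>+y. (\<integral>\<^sup>+z. g (s + y + (\<Sum>i<n. z i)) \<partial>PiM UNIV (\<lambda>_::nat. step_law)) \<partial>step_law)"
    unfolding G_def Suc.IH ..
  also have "\<dots> = (\<integral>\<^sup>+y. g (s + (\<Sum>i<Suc n. y i)) \<partial>PiM UNIV (\<lambda>_::nat. step_law))"
    by (subst nn_integral_PiM_case_nat[OF rho])
      (simp_all add: sum.lessThan_Suc_shift add.assoc del: sum.lessThan_Suc)
  finally show ?case .
qed

section \<open>Normalized particle counts\<close>

text \<open>Holds for an infinite mean as well: the Bochner integral is then 0 by convention, and so
  is \<open>enn2real\<close> of infinity.\<close>

lemma mean_offspring_eq:
  assumes xs: "xs \<in> space envs"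
  shows "mean_offspring eta xs n = enn2real (mean_children (xs n))"
proof -
  have "mean_offspring eta xs n
    = enn2real (\<integral>\<^sup>+X. ennreal (real (offspring X (replicate n 0))) \<partial>quenched eta xs)"
    unfolding mean_offspring_def
    by (rule integral_eq_nn_integral) (simp_all add: measurable_cong_sets[OF sets_quenched[OF xs] refl])
  also have "(\<integral>\<^sup>+X. ennreal (real (offspring X (replicate n 0))) \<partial>quenched eta xs) = mean_children (xs n)"
    unfolding offspring_def mean_children_def ennreal_of_nat_eq_real_of_nat
    by (subst nn_integral_eta_label[OF xs]) simp_all
  finally show ?thesis .
qed

text \<open>Since \<open>enn2real\<close> sends infinity to 0, the single inequality encodes a mean
  that is both positive and finite.\<close>

lemma nondegenerateD:
  assumes "0 < enn2real (mean_children e)"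
  shows "mean_children e = ennreal (enn2real (mean_children e))"
  using assms by (cases "mean_children e") auto

lemma inverse_mean_children:
  assumes "0 < enn2real (mean_children e)"
  shows "inverse (mean_children e) = ennreal (1 / enn2real (mean_children e))"
  using inverse_ennreal[OF assms] nondegenerateD[OF assms] by (simp add: inverse_eq_divide)

lemma step_one:
  assumes "0 < enn2real (mean_children e)"
  shows "step e (\<lambda>_. 1) s = 1"
proof -
  have "step e (\<lambda>_. 1) s = inverse (mean_children e) * mean_children e"
    by (simp add: step_def child_sum_def mean_children_def)
  also have "\<dots> = ennreal (1 / enn2real (mean_children e)) * ennreal (enn2real (mean_children e))"
    unfolding inverse_mean_children[OF assms] using nondegenerateD[OF assms] by simp
  also have "\<dots> = 1"
    using assms by (simp add: ennreal_mult[symmetric])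
  finally show ?thesis .
qed

lemma steps_one:
  assumes "\<And>i. 0 < enn2real (mean_children (xs i))"
  shows "steps xs n (\<lambda>_. 1) s = 1"
  using assms
proof (induction n arbitrary: xs s)
  case (Suc n)
  have "steps (\<lambda>i. xs (Suc i)) n (\<lambda>_. 1) = (\<lambda>_. 1)"
    using Suc by auto
  then show ?case using Suc.prems by (simp add: step_one)
qed simp

lemma integral_quenched_Z:
  assumes xs: "xs \<in> space envs" and A [measurable]: "A \<in> sets borel"
  shows "(\<integral>Y. Z n Y A \<partial>quenched eta xs)
    = enn2real (\<integral>\<^sup>+Y. ennreal (Z n Y A) \<partial>quenched eta xs)"
  by (rule integral_eq_nn_integral)
    (simp_all add: Z_nonneg measurable_cong_sets[OF sets_quenched[OF xs] refl])

lemma measurable_quenched_Z [measurable]: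
  assumes [measurable]: "A \<in> sets borel"
  shows "(\<lambda>xs. \<integral>Y. Z n Y A \<partial>quenched eta xs) \<in> borel_measurable envs"
proof -
  have "(\<lambda>xs. enn2real (\<integral>\<^sup>+Y. ennreal (Z n Y A) \<partial>quenched eta xs)) \<in> borel_measurable envs"
    by (intro borel_measurable_enn2real
        nn_integral_measurable_subprob_algebra2[where N = labelling_space])
      (simp_all add: measurable_prob_algebraD)
  then show ?thesis
    by (simp add: integral_quenched_Z cong: measurable_cong)
qed

text \<open>\<open>many_to_one\<close> is used twice: with the constant 1 it identifies the
  denominator as the product of the means, with the indicator of \<open>A\<close> it evaluates the
  numerator.\<close>

lemma quenched_normalized_Z:
  assumes xs: "xs \<in> space envs" and pos: "\<And>i. 0 < enn2real (mean_children (xs i))"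
    and A [measurable]: "A \<in> sets borel"
  shows "(\<integral>\<^sup>+X. ennreal (Z n X A / (\<integral>Y. Z n Y UNIV \<partial>quenched eta xs)) \<partial>quenched eta xs)
    = steps xs n (indicator A) 0"
proof -
  let ?m = "\<Prod>i<n. enn2real (mean_children (xs i))"
  let ?E = "\<integral>\<^sup>+Y. ennreal (Z n Y UNIV) \<partial>quenched eta xs"
  have m: "0 < ?m" using pos by (simp add: prod_pos)
  have W: "(\<Prod>i<n. inverse (mean_children (xs i))) = ennreal (1 / ?m)"
    using pos by (simp add: inverse_mean_children prod_ennreal prod_dividef less_imp_le)
  have "ennreal (1 / ?m) * ?E = steps xs n (\<lambda>_. 1) 0"
    using many_to_one[OF xs, of "\<lambda>_. 1" n] unfolding W ennreal_Z by simp
  then have 1: "ennreal (1 / ?m) * ?E = 1" by (simp add: steps_one pos)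
  \<comment> \<open>Cancelling \<open>1 / ?m\<close> also shows that \<open>?E\<close> is finite, so
    the denominator is a genuine expectation and not a default value.\<close>
  have "?E = ennreal ?m"
  proof -
    have "ennreal r * ennreal (1 / r) = 1" if "0 < r" for r
      using that by (simp add: ennreal_mult[symmetric])
    then have "?E = ennreal ?m * ennreal (1 / ?m) * ?E"
      by (simp only: m mult_1_left)
    then show ?thesis using 1 by (simp add: mult.assoc)
  qed
  then have M: "(\<integral>Y. Z n Y UNIV \<partial>quenched eta xs) = ?m"
    using m by (simp add: integral_quenched_Z xs)
  have "(\<integral>\<^sup>+X. ennreal (Z n X A / ?m) \<partial>quenched eta xs)
    = (\<integral>\<^sup>+X. ennreal (1 / ?m) * ennreal (Z n X A) \<partial>quenched eta xs)"
    using m by (simp add: ennreal_mult[symmetric] Z_nonneg)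
  also have "\<dots> = ennreal (1 / ?m) * (\<integral>\<^sup>+X. ennreal (Z n X A) \<partial>quenched eta xs)"
    by (rule nn_integral_cmult) (simp add: measurable_cong_sets[OF sets_quenched[OF xs] refl])
  also have "\<dots> = steps xs n (indicator A) 0"
    using many_to_one[OF xs, of "indicator A" n] unfolding W ennreal_Z by simp
  finally show ?thesis unfolding M .
qed

section \<open>Moments under the annealed law and under the averaged step law\<close>

definition child_mean :: "(real \<Rightarrow> real) \<Rightarrow> (nat \<Rightarrow> 'e) \<times> labelling \<Rightarrow> real" where
  "child_mean h = (\<lambda>(xs, X).
     1 / mean_offspring eta xs 0 * (\<Sum>i<offspring X []. h (displacement X [] i)))"

lemma measurable_child_mean [measurable]:
  assumes [measurable]: "h \<in> borel_measurable borel"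
  shows "child_mean h \<in> borel_measurable joint_law"
proof -
  have [measurable]: "(\<lambda>X. \<Sum>i<offspring X []. h (displacement X [] i)) \<in> borel_measurable labelling_space"
    by (rule measurable_sum_upto_random) measurable
  have "(\<lambda>p. 1 / enn2real (mean_children (fst p 0)) *
      (\<Sum>i<offspring (snd p) []. h (displacement (snd p) [] i))) \<in> borel_measurable (envs \<Otimes>\<^sub>M labelling_space)"
    by measurable
  then have "child_mean h \<in> borel_measurable (envs \<Otimes>\<^sub>M labelling_space)"
    by (rule measurable_cong[THEN iffD1, rotated])
      (auto simp: child_mean_def space_pair_measure mean_offspring_eq)
  then show ?thesis by (simp add: measurable_cong_sets[OF sets_joint refl])
qed

lemma child_mean_nonneg:
  assumes "p \<in> space joint_law" "\<And>y. 0 \<le> h y"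
  shows "0 \<le> child_mean h p"
  using assms by (auto simp: child_mean_def sets_eq_imp_space_eq[OF sets_joint] space_pair_measure
      mean_offspring_eq sum_nonneg)

end

locale nondegenerate_random_environment = random_environment Theta eta nu
  for Theta :: "'e measure" and eta nu +
  assumes nondegenerate: "AE e in nu. 0 < enn2real (mean_children e)"
begin

text \<open>For almost every environment the step operator preserves the constant 1; averaging keeps
  the total mass.\<close>

lemma prob_step_law: "prob_space step_law"
proof
  have "emeasure step_law (space step_law) = (\<integral>\<^sup>+y. 1 \<partial>step_law)" by simp
  also have "\<dots> = (\<integral>\<^sup>+e. step e (\<lambda>_. 1) 0 \<partial>nu)" by (rule nn_integral_step_law) simp
  also have "\<dots> = (\<integral>\<^sup>+e. 1 \<partial>nu)"
    by (rule nn_integral_cong_AE) (use nondegenerate in eventually_elim, rule step_one)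
  finally show "emeasure step_law (space step_law) = 1"
    by (simp add: prob_space.emeasure_space_1[OF prob_nu])
qed

lemma AE_env_nondegenerate: "AE xs in env. \<forall>i. 0 < enn2real (mean_children (xs i))"
  unfolding AE_all_countable
  by (intro allI AE_PiM_component nondegenerate prob_nu) simp

lemma annealed_normalized_Z:
  assumes A [measurable]: "A \<in> sets borel"
  shows "(\<integral>(xs, X). Z n X A / (\<integral>Y. Z n Y UNIV \<partial>quenched eta xs) \<partial>joint_law)
    = measure (PiM UNIV (\<lambda>_::nat. step_law))
        {y \<in> space (PiM UNIV (\<lambda>_. step_law)). (\<Sum>i<n. y i) \<in> A}"
proof -
  let ?f = "\<lambda>(xs, X). Z n X A / (\<integral>Y. Z n Y UNIV \<partial>quenched eta xs)"
  let ?R = "PiM UNIV (\<lambda>_::nat. step_law)"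
  have f: "?f \<in> borel_measurable (envs \<Otimes>\<^sub>M labelling_space)"
    unfolding case_prod_beta' by measurable
  have "(\<integral>p. ?f p \<partial>joint_law) = enn2real (\<integral>\<^sup>+p. ennreal (?f p) \<partial>joint_law)"
    by (rule integral_eq_nn_integral)
      (use f in \<open>auto simp: Z_nonneg measurable_cong_sets[OF sets_joint refl]\<close>)
  also have "(\<integral>\<^sup>+p. ennreal (?f p) \<partial>joint_law)
    = (\<integral>\<^sup>+xs. (\<integral>\<^sup>+X. ennreal (?f (xs, X)) \<partial>quenched eta xs) \<partial>env)"
    by (rule nn_integral_joint) (use f in simp)
  also have "\<dots> = (\<integral>\<^sup>+xs. steps xs n (indicator A) 0 \<partial>env)"
  proof (rule nn_integral_cong_AE)
    show "AE xs in env. (\<integral>\<^sup>+X. ennreal (?f (xs, X)) \<partial>quenched eta xs) = steps xs n (indicator A) 0"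
      using AE_env_nondegenerate AE_space
      by eventually_elim (use quenched_normalized_Z A in \<open>simp add: space_env\<close>)
  qed
  also have "\<dots> = (\<integral>\<^sup>+y. indicator A (0 + (\<Sum>i<n. y i)) \<partial>?R)"
    by (rule annealed_steps[OF prob_step_law]) simp
  also have "\<dots> = (\<integral>\<^sup>+y. indicator {y \<in> space ?R. (\<Sum>i<n. y i) \<in> A} y \<partial>?R)"
    by (rule nn_integral_cong) (simp add: indicator_def)
  also have "\<dots> = emeasure ?R {y \<in> space ?R. (\<Sum>i<n. y i) \<in> A}"
    by (rule nn_integral_indicator) measurable
  finally show ?thesis by (simp add: measure_def)
qed

lemma nn_integral_child_mean:
  assumes [measurable]: "h \<in> borel_measurable borel" and nonneg: "\<And>y. 0 \<le> h y"
  shows "(\<integral>\<^sup>+p. ennreal (child_mean h p) \<partial>joint_law) = (\<integral>\<^sup>+y. ennreal (h y) \<partial>step_law)"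
proof -
  have "AE p in joint_law. 0 < enn2real (mean_children (fst p 0))"
  proof (rule AE_joint_fst)
    show "AE xs in env. 0 < enn2real (mean_children (xs 0))"
      using AE_env_nondegenerate by eventually_elim simp
  qed measurable
  moreover have "AE p in joint_law. fst p \<in> space envs"
    by (rule AE_I2) (auto simp: sets_eq_imp_space_eq[OF sets_joint] space_pair_measure)
  ultimately have "AE p in joint_law. ennreal (child_mean h p) = (case p of (xs, X) \<Rightarrow>
    inverse (mean_children (xs 0)) * (\<Sum>i<offspring X []. ennreal (h (displacement X [] i))))"
    by eventually_elim
      (simp add: child_mean_def case_prod_beta' mean_offspring_eq inverse_mean_children
        ennreal_mult sum_ennreal nonneg sum_nonneg del: times_divide_eq_left)
  then have "(\<integral>\<^sup>+p. ennreal (child_mean h p) \<partial>joint_law) = (\<integral>\<^sup>+(xs, X).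
    inverse (mean_children (xs 0)) * (\<Sum>i<offspring X []. ennreal (h (displacement X [] i))) \<partial>joint_law)"
    by (rule nn_integral_cong_AE)
  then show ?thesis by (simp add: nn_integral_step_law_joint)
qed

text \<open>Transfers moments from the annealed law, in which the hypotheses are phrased, to
  \<open>step_law\<close>. For nonnegative \<open>h\<close> integrability can be read off from one
  extended integral.\<close>

lemma
  assumes [measurable]: "h \<in> borel_measurable borel" and nonneg: "\<And>y. 0 \<le> h y"
  shows integrable_child_mean: "integrable joint_law (child_mean h) \<longleftrightarrow> integrable step_law h"
    and integral_child_mean: "(\<integral>p. child_mean h p \<partial>joint_law) = (\<integral>y. h y \<partial>step_law)"
proof -
  have nn: "AE p in joint_law. 0 \<le> child_mean h p"
    by (rule AE_I2) (rule child_mean_nonneg[OF _ nonneg])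
  have "(\<integral>\<^sup>+p. ennreal (norm (child_mean h p)) \<partial>joint_law) = (\<integral>\<^sup>+p. ennreal (child_mean h p) \<partial>joint_law)"
    by (rule nn_integral_cong_AE) (use nn in eventually_elim, simp)
  then show "integrable joint_law (child_mean h) \<longleftrightarrow> integrable step_law h"
    unfolding integrable_iff_bounded using nonneg by (simp add: nn_integral_child_mean)
  show "(\<integral>p. child_mean h p \<partial>joint_law) = (\<integral>y. h y \<partial>step_law)"
    using nn nonneg by (simp add: integral_eq_nn_integral nn_integral_child_mean)
qed

text \<open>A signed \<open>h\<close> is split into positive and negative parts. Integrability is
  demanded under \<open>step_law\<close>, since that of \<open>child_mean h\<close> could come from
  cancellation between siblings inside the sum.\<close>

lemma integral_child_mean_integrable:
  assumes "integrable step_law h"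
  shows "(\<integral>p. child_mean h p \<partial>joint_law) = (\<integral>y. h y \<partial>step_law)"
proof -
  let ?p = "\<lambda>y. max 0 (h y)" and ?n = "\<lambda>y. max 0 (- h y)"
  have [measurable]: "h \<in> borel_measurable borel" using assms by auto
  have int: "integrable step_law ?p" "integrable step_law ?n"
    using assms by auto
  have h: "h y = ?p y - ?n y" for y by auto
  have "child_mean h p = child_mean ?p p - child_mean ?n p" for p
    by (simp add: child_mean_def case_prod_beta' right_diff_distrib[symmetric] sum_subtractf[symmetric] h[symmetric]
      del: times_divide_eq_left)
  then have "(\<integral>p. child_mean h p \<partial>joint_law) = (\<integral>p. child_mean ?p p \<partial>joint_law) - (\<integral>p. child_mean ?n p \<partial>joint_law)"
    using int by (simp add: integrable_child_mean)
  also have "\<dots> = (\<integral>y. ?p y \<partial>step_law) - (\<integral>y. ?n y \<partial>step_law)"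
    by (simp add: integral_child_mean)
  also have "\<dots> = (\<integral>y. ?p y - ?n y \<partial>step_law)"
    using int by simp
  finally show ?thesis unfolding h[symmetric] .
qed

end

section \<open>Passage from the variables \<open>xi\<close> to the product model, and the
  limit\<close>

theorem theorem9p3:
  fixes M :: "'w measure" and Theta :: "'e measure"
    and xi :: "nat \<Rightarrow> 'w \<Rightarrow> 'e" and eta :: "'e \<Rightarrow> label measure"
    and P :: "((nat \<Rightarrow> 'e) \<times> labelling) measure"
    and mu sigma2 sigma :: real and a b :: "nat \<Rightarrow> real"
  assumes prob: "prob_space M"
    and kernel: "eta \<in> Theta \<rightarrow>\<^sub>M prob_algebra label_space"
    and indep: "prob_space.indep_vars M (\<lambda>_. Theta) xi UNIV"
    and ident: "\<And>n. distr M Theta (xi n) = distr M Theta (xi 0)"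
    and standing: "standing_assumption M Theta xi eta"
    and P_eq: "P = annealed M Theta xi eta"
    and mu_finite: "integrable P (\<lambda>(xs, X).
          1 / mean_offspring eta xs 0 * (\<Sum>i<offspring X []. displacement X [] i))"
    and mu_eq: "mu = (\<integral>(xs, X).
          1 / mean_offspring eta xs 0 * (\<Sum>i<offspring X []. displacement X [] i) \<partial>P)"
    and sigma2_finite: "integrable P (\<lambda>(xs, X).
          1 / mean_offspring eta xs 0 * (\<Sum>i<offspring X []. (displacement X [] i - mu)\<^sup>2))"
    and sigma2_eq: "sigma2 = (\<integral>(xs, X).
          1 / mean_offspring eta xs 0 * (\<Sum>i<offspring X []. (displacement X [] i - mu)\<^sup>2) \<partial>P)"
    and sigma2_pos: "0 < sigma2"
    and sigma_eq: "sigma = sqrt sigma2"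
    and a_eq: "\<And>n. a n = real n * mu"
    and b_eq: "\<And>n. b n = sqrt (real n) * sigma"
  shows "\<forall>x::real. (\<lambda>n. \<integral>(xs, X).
           Z n X {..b n * x + a n} / (\<integral>Y. Z n Y UNIV \<partial>quenched eta xs) \<partial>P)
         \<longlonglongrightarrow> cdf std_normal_distribution x"
proof
  fix x :: real
  interpret M: prob_space M by (rule prob)
  define nu where "nu = distr M Theta (xi 0)"
  have rv: "xi n \<in> M \<rightarrow>\<^sub>M Theta" for n
    using indep by (simp add: M.indep_vars_def)
  interpret env: random_environment Theta eta nu
  proof (rule random_environment.intro)
    show "eta \<in> Theta \<rightarrow>\<^sub>M prob_algebra label_space" by (rule kernel)
    show "prob_space nu" unfolding nu_def by (rule M.prob_space_distr[OF rv])
    show "sets nu = sets Theta" unfolding nu_def by (rule sets_distr)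
  qed
  \<comment> \<open>Independence says that the joint law is the product of the marginals, and
    identical distribution makes all of them \<open>nu\<close>.\<close>
  have env_law: "env_law M Theta xi = env.env"
  proof -
    have "distr M Theta (xi n) = nu" for n
      unfolding nu_def by (rule ident)
    then show ?thesis
      using M.indep_vars_iff_distr_eq_PiM[where I = UNIV and M' = "\<lambda>_. Theta" and X = xi] indep rv
      by (simp add: env_law_def restrict_def[abs_def])
  qed
  have P: "P = env.joint_law"
    unfolding P_eq annealed_def env_law env.joint_law_def ..
  have "AE xs in env.env. 0 < mean_offspring eta xs 0"
    using standing unfolding standing_assumption_def env_law by auto
  then have "AE xs in env.env. 0 < enn2real (env.mean_children (xs 0))"
    using AE_space by eventually_elim (simp add: env.mean_offspring_eq env.space_env)
  \<comment> \<open>The almost sure statement concerns whole sequences; pushing forward along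
    coordinate 0 turns it into one about \<open>nu\<close>.\<close>
  then have "AE e in distr env.env nu (\<lambda>xs. xs 0). 0 < enn2real (env.mean_children e)"
    by (subst AE_distr_iff) (auto simp: env.space_nu)
  moreover have comp: "distr env.env nu (\<lambda>xs. xs 0) = nu"
    using distr_PiM_component[of UNIV "\<lambda>_::nat. nu" 0] env.prob_nu by simp
  ultimately have nondegenerate: "AE e in nu. 0 < enn2real (env.mean_children e)"
    by (simp only: comp)
  interpret env: nondegenerate_random_environment Theta eta nu
    by unfold_locales (rule nondegenerate)
  interpret R: prob_space env.step_law by (rule env.prob_step_law)
  have sq_eq: "(\<lambda>(xs, X). 1 / mean_offspring eta xs 0 *
      (\<Sum>i<offspring X []. (displacement X [] i - mu)\<^sup>2)) = env.child_mean (\<lambda>y. (y - mu)\<^sup>2)"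
    by (simp add: env.child_mean_def)
  have sq: "integrable env.step_law (\<lambda>y. (y - mu)\<^sup>2)"
    using sigma2_finite unfolding sq_eq P by (simp add: env.integrable_child_mean)
  have var: "(\<integral>y. (y - mu)\<^sup>2 \<partial>env.step_law) = sigma\<^sup>2"
    using sigma2_eq sigma2_pos unfolding sq_eq P sigma_eq by (simp add: env.integral_child_mean)
  \<comment> \<open>On a probability space the second moment controls the first, which gives the
    integrability under \<open>step_law\<close> that the signed transfer of the mean asks
    for.\<close>
  have "integrable env.step_law (\<lambda>y. y - mu)"
    by (rule R.square_integrable_imp_integrable[OF _ sq]) simp
  then have "integrable env.step_law (\<lambda>y. (y - mu) + mu)"
    by (intro Bochner_Integration.integrable_add) auto
  then have "(\<integral>p. env.child_mean (\<lambda>y. y) p \<partial>env.joint_law) = (\<integral>y. y \<partial>env.step_law)"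
    by (intro env.integral_child_mean_integrable) simp
  then have mean: "(\<integral>y. y \<partial>env.step_law) = mu"
    by (simp add: mu_eq P env.child_mean_def)
  have s: "0 < sigma" using sigma2_pos by (simp add: sigma_eq)
  show "(\<lambda>n. \<integral>(xs, X). Z n X {..b n * x + a n} / (\<integral>Y. Z n Y UNIV \<partial>quenched eta xs) \<partial>P)
      \<longlonglongrightarrow> cdf std_normal_distribution x"
    using iid_central_limit[OF env.prob_step_law env.sets_step_law sq mean var s, of x]
    by (simp add: P env.annealed_normalized_Z a_eq b_eq)
qed

end
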